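(* Let $\overline{E}$ be obtained from $E$ by reducing its coefficients modulo the ideal generated by $2\pi i$, so that they lie in $\overline{\mathcal Z}=\mathcal Z/\langle(2\pi i)^2\rangle$. Then $$\overline{E}=\Gamma_a(\overline\Phi_{KZ}),\qquad\text{where }\Gamma_a(\Psi):=1-a+\Gamma(\Psi)(a).$$
   Context: Let $\mathfrak f_2$ be the completed free Lie algebra on $a,b$. Put $\mathrm{Ber}_x(y)=\frac{\mathrm{ad}(x)}{e^{\mathrm{ad}(x)}-1}(y)$, $t_{01}=\mathrm{Ber}_b(-a)$, $t_{02}=\mathrm{Ber}_{-b}(a)$, $t_{12}=[a,b]$; $t_{01}$ and $b$ topologically generate $\mathfrak f_2$. Let $\mathcal Z$ be the $\mathbb{Q}$-algebra of multiple zeta values and $\Phi_{KZ}(x,y)$ the Drinfeld associator (group-like series whose coefficients are shuffle-regularized multiple zeta values, coefficient of $xy$ equal to $-\zeta(2)$); $\overline\Phi_{KZ}$ is its reduction with coefficients in $\overline{\mathcal Z}$, an element of the graded Grothendieck–Teichmüller group $GRT(\overline{\mathcal Z})$. Let $\sigma$ be the continuous automorphism determined by $\sigma(e^{t_{01}})=\Phi_{KZ}(t_{01},t_{12})e^{t_{01}}\Phi_{KZ}(t_{01},t_{12})^{-1}$, $\sigma(e^b)=e^{\pi i t_{12}}\Phi_{KZ}(t_{02},t_{12})e^b\Phi_{KZ}(t_{01},t_{12})^{-1}$, and $E=1-a+\sigma(a)$. For $\Psi\in GRT$, Enriquez's section $\Gamma$ gives the automorphism $\Gamma(\Psi)$ of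 $\mathfrak f_2$ determined by $\Gamma(\Psi)(t_{01})=\Psi(t_{01},t_{12})\,t_{01}\,\Psi(t_{01},t_{12})^{-1}$ and $\Gamma(\Psi)(b)=\log\bigl(\Psi(t_{02},t_{12})e^b\Psi(t_{01},t_{12})^{-1}\bigr)$. *)

theory Defs
  imports "HOL-Analysis.Analysis" "HOL-Computational_Algebra.Formal_Power_Series"
begin

section \<open>Commutative Q-algebras\<close>

text \<open>
  The axiom \<open>0 \<noteq> 1\<close> is deliberately absent (so this is not a subclass of \<open>comm_ring_1\<close>):
  \<open>0 = 1\<close> in the algebra of multiple zeta values modulo \<open>(2 \<pi> i)\<^sup>2\<close> would mean that
  \<open>1 / \<pi>\<^sup>2\<close> is a multiple zeta value, which is not known to be false.
\<close>

class comm_rat_algebra = comm_ring + comm_monoid_mult +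
  fixes rat_hom :: "rat \<Rightarrow> 'a"
  assumes rat_hom_add: "rat_hom (p + q) = rat_hom p + rat_hom q"
    and rat_hom_mult: "rat_hom (p * q) = rat_hom p * rat_hom q"
    and rat_hom_1: "rat_hom 1 = 1"

instantiation complex :: comm_rat_algebra
begin
definition rat_hom_complex :: "rat \<Rightarrow> complex" where "rat_hom_complex = of_rat"
instance by standard (simp_all add: rat_hom_complex_def of_rat_add of_rat_mult)
end


section \<open>Noncommutative formal power series\<close>

typedef ('l, 'r) ncs = "UNIV :: ('l list \<Rightarrow> 'r) set"
  morphisms ncoeff Abs_ncs by simp

setup_lifting type_definition_ncs

lemma ncs_eqI: "(\<And>w. ncoeff f w = ncoeff g w) \<Longrightarrow> f = g"
  by (simp add: ncoeff_inject[symmetric] fun_eq_iff)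

instantiation ncs :: (type, comm_rat_algebra) "{ring, monoid_mult}"
begin

lift_definition zero_ncs :: "('a, 'b) ncs" is "\<lambda>w. 0" .
lift_definition one_ncs :: "('a, 'b) ncs" is "\<lambda>w. if w = [] then 1 else 0" .
lift_definition plus_ncs :: "('a, 'b) ncs \<Rightarrow> ('a, 'b) ncs \<Rightarrow> ('a, 'b) ncs"
  is "\<lambda>f g w. f w + g w" .
lift_definition minus_ncs :: "('a, 'b) ncs \<Rightarrow> ('a, 'b) ncs \<Rightarrow> ('a, 'b) ncs"
  is "\<lambda>f g w. f w - g w" .
lift_definition uminus_ncs :: "('a, 'b) ncs \<Rightarrow> ('a, 'b) ncs" is "\<lambda>f w. - f w" .
lift_definition times_ncs :: "('a, 'b) ncs \<Rightarrow> ('a, 'b) ncs \<Rightarrow> ('a, 'b) ncs"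
  is "\<lambda>f g w. \<Sum>k=0..length w. f (take k w) * g (drop k w)" .

instance
proof
  fix f g h :: "('a, 'b) ncs"
  show "f * g * h = f * (g * h)"
  proof (rule ncs_eqI)
    fix w :: "'a list"
    let ?n = "length w"
    define F where "F i l m = ncoeff f (take i w) * ncoeff g (take l (drop i w)) * ncoeff h (drop (i + l) w)"
      for i l m :: nat
    have "ncoeff (f * g * h) w = (\<Sum>j=0..?n. \<Sum>i=0..j. F i (j - i) (?n - j))"
      unfolding times_ncs.rep_eq
      by (intro sum.cong refl)
         (auto simp: F_def sum_distrib_right min_def drop_take intro!: sum.cong)
    also have "\<dots> = (\<Sum>j=0..?n. \<Sum>i=0..?n - j. F j i (?n - j - i))"
      by (rule fps_mult_assoc_lemma)
    also have "\<dots> = ncoeff (f * (g * h)) w"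
      unfolding times_ncs.rep_eq
      by (intro sum.cong refl)
         (auto simp: F_def sum_distrib_left mult.assoc add.commute intro!: sum.cong)
    finally show "ncoeff (f * g * h) w = ncoeff (f * (g * h)) w" .
  qed
  show "1 * f = f"
  proof (rule ncs_eqI)
    fix w
    have "ncoeff (1 * f) w = (\<Sum>k=0..length w. if k = 0 then ncoeff f w else 0)"
      unfolding times_ncs.rep_eq one_ncs.rep_eq by (intro sum.cong) auto
    then show "ncoeff (1 * f) w = ncoeff f w" by simp
  qed
  show "f * 1 = f"
  proof (rule ncs_eqI)
    fix w
    have "ncoeff (f * 1) w = (\<Sum>k=0..length w. if k = length w then ncoeff f w else 0)"
      unfolding times_ncs.rep_eq one_ncs.rep_eq by (intro sum.cong) auto
    then show "ncoeff (f * 1) w = ncoeff f w" by simp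
  qed
qed (transfer; force simp: algebra_simps sum.distrib)+

end

definition nletter :: "'l \<Rightarrow> ('l, 'r::comm_rat_algebra) ncs" where
  "nletter l = Abs_ncs (\<lambda>w. if w = [l] then 1 else 0)"

definition nscale :: "'r \<Rightarrow> ('l, 'r::comm_rat_algebra) ncs \<Rightarrow> ('l, 'r) ncs" where
  "nscale c f = Abs_ncs (\<lambda>w. c * ncoeff f w)"

definition ninverse :: "('l, 'r::comm_rat_algebra) ncs \<Rightarrow> ('l, 'r) ncs" where
  "ninverse g = (THE h. g * h = 1 \<and> h * g = 1)"

definition bracket :: "('l, 'r::comm_rat_algebra) ncs \<Rightarrow> ('l, 'r) ncs \<Rightarrow> ('l, 'r) ncs" where
  "bracket f g = f * g - g * f"

definition ord_ge :: "nat \<Rightarrow> ('l, 'r::comm_rat_algebra) ncs \<Rightarrow> bool" where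
  "ord_ge n f \<longleftrightarrow> (\<forall>w. length w < n \<longrightarrow> ncoeff f w = 0)"

text \<open>
  In the three definitions below the inserted series are required to have constant term \<open>0\<close>.
  Then \<open>u ^ n\<close>, \<open>(ad x)\<^sup>n y\<close> and a product of \<open>n\<close> inserted series have order at least \<open>n\<close>, so
  that truncating the infinite sum at the length of the word does not change the coefficient.
\<close>

definition fps_at :: "rat fps \<Rightarrow> ('l, 'r::comm_rat_algebra) ncs \<Rightarrow> ('l, 'r) ncs" where
  "fps_at F u = Abs_ncs (\<lambda>w. \<Sum>n\<le>length w. rat_hom (fps_nth F n) * ncoeff (u ^ n) w)"

definition fps_ad ::
  "rat fps \<Rightarrow> ('l, 'r::comm_rat_algebra) ncs \<Rightarrow> ('l, 'r) ncs \<Rightarrow> ('l, 'r) ncs" where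
  "fps_ad F x y =
     Abs_ncs (\<lambda>w. \<Sum>n\<le>length w. rat_hom (fps_nth F n) * ncoeff ((bracket x ^^ n) y) w)"

definition nsubst ::
  "('l::finite, 'r::comm_rat_algebra) ncs \<Rightarrow> ('l \<Rightarrow> ('m, 'r) ncs) \<Rightarrow> ('m, 'r) ncs" where
  "nsubst \<Psi> \<theta> =
     Abs_ncs (\<lambda>z. \<Sum>w | length w \<le> length z. ncoeff \<Psi> w * ncoeff (prod_list (map \<theta> w)) z)"

definition nexp :: "('l, 'r::comm_rat_algebra) ncs \<Rightarrow> ('l, 'r) ncs" where
  "nexp u = fps_at (fps_exp 1) u"

text \<open>\<^term>\<open>fps_ln 1\<close> is the series of \<open>log (1 + X)\<close>.\<close>

definition nlog :: "('l, 'r::comm_rat_algebra) ncs \<Rightarrow> ('l, 'r) ncs" where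
  "nlog g = fps_at (fps_ln 1) (g - 1)"

definition Ber :: "('l, 'r::comm_rat_algebra) ncs \<Rightarrow> ('l, 'r) ncs \<Rightarrow> ('l, 'r) ncs" where
  "Ber x y = fps_ad (fps_X / (fps_exp 1 - 1)) x y"


section \<open>The completed free Lie algebra on two generators\<close>

datatype letter_ab = A | B

definition gen_a :: "(letter_ab, 'r::comm_rat_algebra) ncs" where "gen_a = nletter A"
definition gen_b :: "(letter_ab, 'r::comm_rat_algebra) ncs" where "gen_b = nletter B"

text \<open>
  The Lie subalgebra generated by the letters in the free associative algebra is the free Lie
  algebra; its closure for the degree topology is the completed free Lie algebra, here with
  coefficients extended from the rationals to \<open>'r\<close>.
\<close>

inductive_set lie_polys :: "(letter_ab, 'r::comm_rat_algebra) ncs set" where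
  lie_a: "gen_a \<in> lie_polys"
| lie_b: "gen_b \<in> lie_polys"
| lie_zero: "0 \<in> lie_polys"
| lie_add: "f \<in> lie_polys \<Longrightarrow> g \<in> lie_polys \<Longrightarrow> f + g \<in> lie_polys"
| lie_scale: "f \<in> lie_polys \<Longrightarrow> nscale c f \<in> lie_polys"
| lie_bracket: "f \<in> lie_polys \<Longrightarrow> g \<in> lie_polys \<Longrightarrow> bracket f g \<in> lie_polys"

definition f2 :: "(letter_ab, 'r::comm_rat_algebra) ncs set" where
  "f2 = {f. \<forall>n. \<exists>p\<in>lie_polys. ord_ge n (f - p)}"

definition f2_continuous ::
  "((letter_ab, 'r::comm_rat_algebra) ncs \<Rightarrow> (letter_ab, 'r) ncs) \<Rightarrow> bool" where
  "f2_continuous \<phi> \<longleftrightarrow>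
     (\<forall>f\<in>f2. \<forall>n. \<exists>m. \<forall>g\<in>f2. ord_ge m (g - f) \<longrightarrow> ord_ge n (\<phi> g - \<phi> f))"

definition continuous_f2_automorphism ::
  "((letter_ab, 'r::comm_rat_algebra) ncs \<Rightarrow> (letter_ab, 'r) ncs) \<Rightarrow> bool" where
  "continuous_f2_automorphism \<phi> \<longleftrightarrow>
     bij_betw \<phi> f2 f2 \<and>
     (\<forall>f\<in>f2. \<forall>g\<in>f2. \<phi> (f + g) = \<phi> f + \<phi> g) \<and>
     (\<forall>c. \<forall>f\<in>f2. \<phi> (nscale c f) = nscale c (\<phi> f)) \<and>
     (\<forall>f\<in>f2. \<forall>g\<in>f2. \<phi> (bracket f g) = bracket (\<phi> f) (\<phi> g)) \<and>
     f2_continuous \<phi>"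

definition t01 :: "(letter_ab, 'r::comm_rat_algebra) ncs" where "t01 = Ber gen_b (- gen_a)"
definition t02 :: "(letter_ab, 'r::comm_rat_algebra) ncs" where "t02 = Ber (- gen_b) gen_a"
definition t12 :: "(letter_ab, 'r::comm_rat_algebra) ncs" where "t12 = bracket gen_a gen_b"


section \<open>Multiple zeta values\<close>

text \<open>Convention: \<open>\<zeta>(k\<^sub>1, \<dots>, k\<^sub>r)\<close> sums over \<open>m\<^sub>1 > \<dots> > m\<^sub>r > 0\<close>, so convergence means \<open>k\<^sub>1 \<ge> 2\<close>.\<close>

definition mzv :: "nat list \<Rightarrow> real" where
  "mzv ks = (\<Sum>\<^sub>\<infinity>ms | length ms = length ks \<and> sorted_wrt (>) ms \<and> (\<forall>m\<in>set ms. 0 < m).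
               \<Prod>j<length ks. 1 / real (ms ! j) ^ (ks ! j))"

definition admissible :: "nat list \<Rightarrow> bool" where
  "admissible ks \<longleftrightarrow> (\<forall>k\<in>set ks. 1 \<le> k) \<and> (ks \<noteq> [] \<longrightarrow> 2 \<le> hd ks)"

inductive_set MZV :: "complex set" where
  MZV_rat: "of_rat q \<in> MZV"
| MZV_mzv: "admissible ks \<Longrightarrow> of_real (mzv ks) \<in> MZV"
| MZV_add: "x \<in> MZV \<Longrightarrow> y \<in> MZV \<Longrightarrow> x + y \<in> MZV"
| MZV_mult: "x \<in> MZV \<Longrightarrow> y \<in> MZV \<Longrightarrow> x * y \<in> MZV"

abbreviation two_pi_i :: complex where "two_pi_i \<equiv> 2 * of_real pi * \<i>"

text \<open>The ring \<open>Z[2 \<pi> i]\<close>, where \<open>Z\<close> is \<^term>\<open>MZV\<close>.\<close>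

inductive_set MZV_2pii :: "complex set" where
  MZV_2pii_base: "x \<in> MZV \<Longrightarrow> x \<in> MZV_2pii"
| MZV_2pii_gen: "two_pi_i \<in> MZV_2pii"
| MZV_2pii_add: "x \<in> MZV_2pii \<Longrightarrow> y \<in> MZV_2pii \<Longrightarrow> x + y \<in> MZV_2pii"
| MZV_2pii_mult: "x \<in> MZV_2pii \<Longrightarrow> y \<in> MZV_2pii \<Longrightarrow> x * y \<in> MZV_2pii"

lemma MZV_0: "0 \<in> MZV" using MZV_rat[of 0] by simp
lemma MZV_1: "1 \<in> MZV" using MZV_rat[of 1] by simp
lemma MZV_uminus: "x \<in> MZV \<Longrightarrow> - x \<in> MZV" using MZV_mult[OF MZV_rat[of "-1"], of x] by (simp add: of_rat_minus)
lemma MZV_diff: "x \<in> MZV \<Longrightarrow> y \<in> MZV \<Longrightarrow> x - y \<in> MZV" using MZV_add[OF _ MZV_uminus] by force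

lemma MZV_real: "x \<in> MZV \<Longrightarrow> Im x = 0"
proof (induction rule: MZV.induct)
  case (MZV_rat q)
  have "(of_rat q :: complex) = of_real (of_rat q)"
    by (cases q) (simp add: of_rat_rat)
  then show ?case by (metis Im_complex_of_real)
qed auto

lemma mzv_2: "mzv [2] = pi\<^sup>2 / 6"
proof -
  have set_eq: "{ms. length ms = length [2::nat] \<and> sorted_wrt (>) ms \<and> (\<forall>m\<in>set ms. 0 < m)}
      = (\<lambda>n. [Suc n]) ` UNIV" (is "?L = ?R")
  proof
    show "?L \<subseteq> ?R"
    proof
      fix ms :: "nat list" assume "ms \<in> ?L"
      then obtain m where "ms = [m]" "0 < m" by (auto simp: length_Suc_conv)
      then show "ms \<in> ?R" by (cases m) auto
    qed
  qed auto
  have "mzv [2] = (\<Sum>\<^sub>\<infinity>n. 1 / real (Suc n) ^ 2)"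
    unfolding mzv_def set_eq
    by (subst infsum_reindex) (auto simp: inj_on_def o_def)
  also have "((\<lambda>n. 1 / real (Suc n) ^ 2) has_sum (pi\<^sup>2 / 6)) UNIV"
    using inverse_squares_sums
    by (intro sums_nonneg_imp_has_sum) (auto simp: add.commute)
  then have "(\<Sum>\<^sub>\<infinity>n. 1 / real (Suc n) ^ 2) = pi\<^sup>2 / 6" by (rule infsumI)
  finally show ?thesis .
qed

lemma two_pi_i_sq: "two_pi_i\<^sup>2 \<in> MZV"
proof -
  have "two_pi_i\<^sup>2 = of_rat (-24) * of_real (mzv [2])"
    by (simp add: mzv_2 power_mult_distrib of_rat_minus)
  then show ?thesis by (simp only:) (intro MZV_mult MZV_rat MZV_mzv; simp add: admissible_def)
qed

lemma MZV_2pii_iff: "z \<in> MZV_2pii \<longleftrightarrow> (\<exists>x\<in>MZV. \<exists>y\<in>MZV. z = x + two_pi_i * y)"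
proof
  assume "z \<in> MZV_2pii"
  then show "\<exists>x\<in>MZV. \<exists>y\<in>MZV. z = x + two_pi_i * y"
  proof (induction rule: MZV_2pii.induct)
    case (MZV_2pii_base x) then show ?case using MZV_0 by force
  next
    case MZV_2pii_gen then show ?case using MZV_0 MZV_1 by force
  next
    case (MZV_2pii_add z z')
    then obtain x y x' y' where "x \<in> MZV" "y \<in> MZV" "x' \<in> MZV" "y' \<in> MZV"
      "z = x + two_pi_i * y" "z' = x' + two_pi_i * y'" by auto
    then show ?case
      by (intro bexI[of _ "x + x'"] bexI[of _ "y + y'"]) (auto simp: algebra_simps intro: MZV_add)
  next
    case (MZV_2pii_mult z z')
    then obtain x y x' y' where *: "x \<in> MZV" "y \<in> MZV" "x' \<in> MZV" "y' \<in> MZV"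
      "z = x + two_pi_i * y" "z' = x' + two_pi_i * y'" by auto
    show ?case
    proof (intro bexI)
      show "z * z' = (x * x' + two_pi_i\<^sup>2 * (y * y')) + two_pi_i * (x * y' + y * x')"
        unfolding * by algebra
      show "x * x' + two_pi_i\<^sup>2 * (y * y') \<in> MZV" "x * y' + y * x' \<in> MZV"
        using * two_pi_i_sq by (intro MZV_add MZV_mult; simp)+
    qed
  qed
qed (auto intro: MZV_2pii.intros)


section \<open>Multiple zeta values modulo \<open>2 \<pi> i\<close>\<close>

definition mzvbar_rel :: "complex \<Rightarrow> complex \<Rightarrow> bool" where
  "mzvbar_rel x y \<longleftrightarrow> x \<in> MZV \<and> y \<in> MZV \<and> (\<exists>z\<in>MZV. x - y = two_pi_i\<^sup>2 * z)"

quotient_type mzvbar = complex / partial: mzvbar_rel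
proof (rule part_equivpI)
  show "\<exists>x. mzvbar_rel x x" using MZV_0 by (force simp: mzvbar_rel_def)
  show "symp mzvbar_rel"
    by (rule sympI) (metis MZV_uminus minus_diff_eq mult_minus_right mzvbar_rel_def)
  show "transp mzvbar_rel"
  proof (rule transpI)
    fix x y z assume "mzvbar_rel x y" "mzvbar_rel y z"
    then obtain u v where "x \<in> MZV" "z \<in> MZV" "u \<in> MZV" "v \<in> MZV"
        "x - y = two_pi_i\<^sup>2 * u" "y - z = two_pi_i\<^sup>2 * v"
      by (auto simp: mzvbar_rel_def)
    moreover from this have "x - z = two_pi_i\<^sup>2 * (u + v)" by algebra
    ultimately show "mzvbar_rel x z" unfolding mzvbar_rel_def using MZV_add by blast
  qed
qed

lemma mzvbar_rel_refl: "x \<in> MZV \<Longrightarrow> mzvbar_rel x x"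
  unfolding mzvbar_rel_def using MZV_0 by force

lemma mzvbar_rel_add:
  assumes "mzvbar_rel x x'" "mzvbar_rel y y'" shows "mzvbar_rel (x + y) (x' + y')"
proof -
  obtain u v where "u \<in> MZV" "v \<in> MZV" "x - x' = two_pi_i\<^sup>2 * u" "y - y' = two_pi_i\<^sup>2 * v"
    using assms by (auto simp: mzvbar_rel_def)
  moreover from this have "(x + y) - (x' + y') = two_pi_i\<^sup>2 * (u + v)" by algebra
  ultimately show ?thesis using assms unfolding mzvbar_rel_def using MZV_add by blast
qed

lemma mzvbar_rel_mult:
  assumes "mzvbar_rel x x'" "mzvbar_rel y y'" shows "mzvbar_rel (x * y) (x' * y')"
proof -
  obtain u v where *: "u \<in> MZV" "v \<in> MZV" "x - x' = two_pi_i\<^sup>2 * u" "y - y' = two_pi_i\<^sup>2 * v"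
    using assms by (auto simp: mzvbar_rel_def)
  have "x * y - x' * y' = (x - x') * y + x' * (y - y')" by (simp add: algebra_simps)
  also have "\<dots> = two_pi_i\<^sup>2 * (u * y + x' * v)" unfolding * by algebra
  finally show ?thesis using assms * unfolding mzvbar_rel_def using MZV_add MZV_mult by blast
qed

lemma mzvbar_rel_uminus: "mzvbar_rel x x' \<Longrightarrow> mzvbar_rel (- x) (- x')"
  using mzvbar_rel_mult[of "-1" "-1" x x'] mzvbar_rel_refl[OF MZV_uminus[OF MZV_1]] by simp

instantiation mzvbar :: comm_rat_algebra
begin
lift_definition zero_mzvbar :: mzvbar is 0 by (rule mzvbar_rel_refl[OF MZV_0])
lift_definition one_mzvbar :: mzvbar is 1 by (rule mzvbar_rel_refl[OF MZV_1])
lift_definition plus_mzvbar :: "mzvbar \<Rightarrow> mzvbar \<Rightarrow> mzvbar" is "(+)" by (rule mzvbar_rel_add)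
lift_definition times_mzvbar :: "mzvbar \<Rightarrow> mzvbar \<Rightarrow> mzvbar" is "(*)" by (rule mzvbar_rel_mult)
lift_definition uminus_mzvbar :: "mzvbar \<Rightarrow> mzvbar" is uminus by (rule mzvbar_rel_uminus)
lift_definition minus_mzvbar :: "mzvbar \<Rightarrow> mzvbar \<Rightarrow> mzvbar" is "(-)"
  using mzvbar_rel_add mzvbar_rel_uminus by fastforce
lift_definition rat_hom_mzvbar :: "rat \<Rightarrow> mzvbar" is of_rat by (rule mzvbar_rel_refl[OF MZV_rat])

instance
proof
  fix x y z :: mzvbar and p q :: rat
  have [simp]: "mzvbar_rel u u \<longleftrightarrow> u \<in> MZV" for u
    using mzvbar_rel_refl[of u] by (auto simp: mzvbar_rel_def)
  note [intro] = MZV_add MZV_mult MZV_uminus MZV_diff MZV_0 MZV_1 MZV_rat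
  show "x + y + z = x + (y + z)" by transfer (auto simp: add.assoc)
  show "x + y = y + x" by transfer (auto simp: add.commute)
  show "0 + x = x" by transfer auto
  show "- x + x = 0" by transfer auto
  show "x - y = x + - y" by transfer auto
  show "x * y * z = x * (y * z)" by transfer (auto simp: mult.assoc)
  show "x * y = y * x" by transfer (auto simp: mult.commute)
  show "(x + y) * z = x * z + y * z" by transfer (auto simp: distrib_right)
  show "1 * x = x" by transfer auto
  show "rat_hom (p + q) = (rat_hom p + rat_hom q :: mzvbar)"
    by transfer (auto simp: of_rat_add)
  show "rat_hom (p * q) = (rat_hom p * rat_hom q :: mzvbar)"
    by transfer (auto simp: of_rat_mult)
  show "rat_hom 1 = (1 :: mzvbar)" by transfer auto
qed
end

text \<open>
  Reduction \<open>Z[2 \<pi> i] \<rightarrow> Z[2 \<pi> i] / (2 \<pi> i) = Z / (2 \<pi> i)\<^sup>2\<close>; the value is meaningful only on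
  \<^term>\<open>MZV_2pii\<close>.  The lemmas below show that it is the surjective ring homomorphism with
  kernel \<open>2 \<pi> i Z[2 \<pi> i]\<close> extending the projection from \<open>Z\<close>.
\<close>

definition red :: "complex \<Rightarrow> mzvbar" where
  "red z = abs_mzvbar (SOME x. x \<in> MZV \<and> (\<exists>y\<in>MZV_2pii. z - x = two_pi_i * y))"

lemma abs_mzvbar_eq_iff:
  "x \<in> MZV \<Longrightarrow> y \<in> MZV \<Longrightarrow> abs_mzvbar x = abs_mzvbar y \<longleftrightarrow> (\<exists>z\<in>MZV. x - y = two_pi_i\<^sup>2 * z)"
  using Quotient3_rel[OF Quotient3_mzvbar, of x y] mzvbar_rel_refl[of x] mzvbar_rel_refl[of y]
  by (auto simp: mzvbar_rel_def)

lemma MZV_2pii_uminus: "z \<in> MZV_2pii \<Longrightarrow> - z \<in> MZV_2pii"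
  using MZV_2pii_mult[OF MZV_2pii_base[OF MZV_uminus[OF MZV_1]], of z] by simp

lemma MZV_inter_ideal:
  assumes "x \<in> MZV" "z \<in> MZV_2pii" "x = two_pi_i * z"
  shows "\<exists>y\<in>MZV. x = two_pi_i\<^sup>2 * y"
proof -
  obtain u v where uv: "u \<in> MZV" "v \<in> MZV" "z = u + two_pi_i * v"
    using assms(2) by (auto simp: MZV_2pii_iff)
  have "Im x = 2 * pi * Re u" using assms(3) uv(3) MZV_real[OF uv(2)] by simp
  then have "u = 0" using MZV_real[OF assms(1)] MZV_real[OF uv(1)] by (simp add: complex_eq_iff)
  then have "x = two_pi_i\<^sup>2 * v" using assms(3) uv(3) by (simp add: power2_eq_square)
  then show ?thesis using uv by blast
qed

lemma red_eqI:
  assumes "x \<in> MZV" "y \<in> MZV_2pii" "z = x + two_pi_i * y"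
  shows "red z = abs_mzvbar x"
proof -
  let ?P = "\<lambda>x. x \<in> MZV \<and> (\<exists>y\<in>MZV_2pii. z - x = two_pi_i * y)"
  have "?P x" using assms by auto
  then have "?P (Eps ?P)" by (rule someI)
  then obtain y' where *: "Eps ?P \<in> MZV" "y' \<in> MZV_2pii" "z - Eps ?P = two_pi_i * y'" by blast
  have "Eps ?P - x = two_pi_i * (y + - y')"
    using *(3) assms(3) by (simp add: algebra_simps)
  then have "\<exists>t\<in>MZV. Eps ?P - x = two_pi_i\<^sup>2 * t"
    by (rule MZV_inter_ideal[OF MZV_diff[OF *(1) assms(1)]
          MZV_2pii_add[OF assms(2) MZV_2pii_uminus[OF *(2)]]])
  then show ?thesis unfolding red_def using abs_mzvbar_eq_iff * assms(1) by blast
qed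

lemma red_MZV: "x \<in> MZV \<Longrightarrow> red x = abs_mzvbar x"
  by (rule red_eqI[where y = 0]) (auto intro: MZV_2pii_base MZV_0)

lemma red_surj: "\<exists>x\<in>MZV. red x = c"
proof -
  have "mzvbar_rel (rep_mzvbar c) (rep_mzvbar c)"
    by (rule Quotient3_rep_reflp[OF Quotient3_mzvbar])
  then have "rep_mzvbar c \<in> MZV" by (simp add: mzvbar_rel_def)
  moreover have "abs_mzvbar (rep_mzvbar c) = c" by (rule Quotient3_abs_rep[OF Quotient3_mzvbar])
  ultimately show ?thesis using red_MZV by metis
qed

lemma abs_mzvbar_add: "x \<in> MZV \<Longrightarrow> y \<in> MZV \<Longrightarrow> abs_mzvbar (x + y) = abs_mzvbar x + abs_mzvbar y"
  by (simp add: plus_mzvbar.abs_eq mzvbar_rel_refl)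

lemma abs_mzvbar_mult: "x \<in> MZV \<Longrightarrow> y \<in> MZV \<Longrightarrow> abs_mzvbar (x * y) = abs_mzvbar x * abs_mzvbar y"
  by (simp add: times_mzvbar.abs_eq mzvbar_rel_refl)

lemma red_add:
  assumes "z \<in> MZV_2pii" "z' \<in> MZV_2pii" shows "red (z + z') = red z + red z'"
proof -
  obtain x y x' y' where *: "x \<in> MZV" "y \<in> MZV" "x' \<in> MZV" "y' \<in> MZV"
    "z = x + two_pi_i * y" "z' = x' + two_pi_i * y'" using assms by (auto simp: MZV_2pii_iff)
  have "z + z' = (x + x') + two_pi_i * (y + y')" unfolding * by algebra
  then have "red (z + z') = abs_mzvbar (x + x')"
    using * by (intro red_eqI) (auto intro: MZV_add MZV_2pii_base)
  moreover have "red z = abs_mzvbar x" "red z' = abs_mzvbar x'"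
    using * red_eqI[OF _ MZV_2pii_base] by blast+
  ultimately show ?thesis using * by (simp add: abs_mzvbar_add)
qed

lemma red_mult:
  assumes "z \<in> MZV_2pii" "z' \<in> MZV_2pii" shows "red (z * z') = red z * red z'"
proof -
  obtain x y x' y' where *: "x \<in> MZV" "y \<in> MZV" "x' \<in> MZV" "y' \<in> MZV"
    "z = x + two_pi_i * y" "z' = x' + two_pi_i * y'" using assms by (auto simp: MZV_2pii_iff)
  have "z * z' = (x * x') + two_pi_i * (x * y' + y * x' + two_pi_i * (y * y'))" unfolding * by algebra
  then have "red (z * z') = abs_mzvbar (x * x')"
    using * by (intro red_eqI) (auto intro!: MZV_mult MZV_2pii_add MZV_2pii_mult MZV_2pii_gen
        intro: MZV_2pii_base)
  moreover have "red z = abs_mzvbar x" "red z' = abs_mzvbar x'"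
    using * red_eqI[OF _ MZV_2pii_base] by blast+
  ultimately show ?thesis using * by (simp add: abs_mzvbar_mult)
qed

lemma red_rat: "red (of_rat q) = rat_hom q"
  by (simp add: red_MZV MZV_rat rat_hom_mzvbar.abs_eq)

lemma red_eq_0_iff:
  assumes "z \<in> MZV_2pii" shows "red z = 0 \<longleftrightarrow> (\<exists>y\<in>MZV_2pii. z = two_pi_i * y)"
proof -
  obtain x y where *: "x \<in> MZV" "y \<in> MZV" "z = x + two_pi_i * y"
    using assms by (auto simp: MZV_2pii_iff)
  have "red z = abs_mzvbar x" using * red_eqI[OF _ MZV_2pii_base] by blast
  then have "red z = 0 \<longleftrightarrow> (\<exists>t\<in>MZV. x = two_pi_i\<^sup>2 * t)"
    using abs_mzvbar_eq_iff[OF *(1) MZV_0] by (simp add: zero_mzvbar_def)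
  also have "\<dots> \<longleftrightarrow> (\<exists>y\<in>MZV_2pii. z = two_pi_i * y)"
  proof
    assume "\<exists>t\<in>MZV. x = two_pi_i\<^sup>2 * t"
    then obtain t where t: "t \<in> MZV" "x = two_pi_i\<^sup>2 * t" by blast
    have "z = two_pi_i * (y + two_pi_i * t)" unfolding *(3) t(2) by algebra
    then show "\<exists>y\<in>MZV_2pii. z = two_pi_i * y"
      using t * by (blast intro: MZV_2pii.intros)
  next
    assume "\<exists>y\<in>MZV_2pii. z = two_pi_i * y"
    then obtain y' where y': "y' \<in> MZV_2pii" "z = two_pi_i * y'" by blast
    have "x = two_pi_i * (y' + - y)" using *(3) y'(2) by (simp add: algebra_simps)
    then show "\<exists>t\<in>MZV. x = two_pi_i\<^sup>2 * t"
      by (rule MZV_inter_ideal[OF *(1) MZV_2pii_add[OF y'(1) MZV_2pii_uminus[OF MZV_2pii_base[OF *(2)]]]])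
  qed
  finally show ?thesis .
qed

definition reduce_series :: "('l, complex) ncs \<Rightarrow> ('l, mzvbar) ncs" where
  "reduce_series f = Abs_ncs (\<lambda>w. red (ncoeff f w))"


section \<open>The Drinfeld associator\<close>

datatype letter_xy = X | Y

instance letter_xy :: finite
proof
  have "(UNIV :: letter_xy set) = {X, Y}" using letter_xy.exhaust by blast
  then show "finite (UNIV :: letter_xy set)" by (metis finite.emptyI finite.insertI)
qed

text \<open>The word \<open>X\<^bsup>k\<^sub>1-1\<^esup> Y \<dots> X\<^bsup>k\<^sub>r-1\<^esup> Y\<close> is sent to \<open>[k\<^sub>1, \<dots>, k\<^sub>r]\<close>; the first argument is an accumulator.\<close>

fun word_index :: "nat \<Rightarrow> letter_xy list \<Rightarrow> nat list" where
  "word_index n [] = []"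
| "word_index n (X # w) = word_index (Suc n) w"
| "word_index n (Y # w) = Suc n # word_index 0 w"

definition convergent_word :: "letter_xy list \<Rightarrow> bool" where
  "convergent_word w \<longleftrightarrow> w = [] \<or> (hd w = X \<and> last w = Y)"

definition zeta_word :: "letter_xy list \<Rightarrow> real" where
  "zeta_word w = (if convergent_word w then mzv (word_index 0 w) else 0)"

text \<open>All shuffles of two words, with multiplicity (unlike the library's \<^const>\<open>shuffles\<close>).\<close>

fun shuffle :: "'l list \<Rightarrow> 'l list \<Rightarrow> 'l list list" where
  "shuffle [] v = [v]"
| "shuffle u [] = [u]"
| "shuffle (x # u) (y # v) = map ((#) x) (shuffle u (y # v)) @ map ((#) y) (shuffle (x # u) v)"

text \<open>
  Shuffle regularization: the extension of \<open>\<zeta>\<close> from convergent words to all words as a homomorphism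
  for the shuffle product vanishing on \<open>X\<close> and \<open>Y\<close>.  It is given by the classical closed formula:
  for \<open>w = Y\<^sup>r v X\<^sup>s\<close> with \<open>v\<close> convergent, sum \<open>(-1)\<^bsup>i+j\<^esup>\<close> times \<open>\<zeta>\<close> of the convergent part of the
  shuffle product of \<open>Y\<^sup>i\<close>, \<open>Y\<^bsup>r-i\<^esup> v X\<^bsup>s-j\<^esup>\<close> and \<open>X\<^sup>j\<close>.
\<close>

definition zeta_reg :: "letter_xy list \<Rightarrow> real" where
  "zeta_reg w =
    (let r = length (takeWhile (\<lambda>l. l = Y) w);
         u = drop r w;
         s = length (takeWhile (\<lambda>l. l = X) (rev u));
         v = take (length u - s) u
     in \<Sum>i\<le>r. \<Sum>j\<le>s. (-1) ^ (i + j) *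
          sum_list (map zeta_word (concat (map (shuffle (replicate i Y))
            (shuffle (replicate (r - i) Y @ v @ replicate (s - j) X) (replicate j X))))))"

definition Phi_KZ :: "(letter_xy, complex) ncs" where
  "Phi_KZ = Abs_ncs (\<lambda>w. of_real ((-1) ^ count_list w Y * zeta_reg w))"

definition eval_xy :: "(letter_xy, 'r::comm_rat_algebra) ncs \<Rightarrow>
    (letter_ab, 'r) ncs \<Rightarrow> (letter_ab, 'r) ncs \<Rightarrow> (letter_ab, 'r) ncs" where
  "eval_xy \<Psi> u v = nsubst \<Psi> (case_letter_xy u v)"

lemma Phi_KZ_XY: "ncoeff Phi_KZ [X, Y] = - of_real (mzv [2])"
  by (simp add: Phi_KZ_def Abs_ncs_inverse zeta_reg_def zeta_word_def convergent_word_def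
      numeral_2_eq_2)

lemma zeta_word_MZV: "complex_of_real (zeta_word w) \<in> MZV"
proof -
  have pos: "\<forall>k\<in>set (word_index n w). 1 \<le> k" for n
    by (induction n w rule: word_index.induct) auto
  have hd_ge: "word_index n w \<noteq> [] \<Longrightarrow> Suc n \<le> hd (word_index n w)" for n w
    by (induction n w rule: word_index.induct) auto
  show ?thesis
  proof (cases "convergent_word w")
    case True
    have "word_index 0 w \<noteq> [] \<longrightarrow> 2 \<le> hd (word_index 0 w)"
    proof (cases w)
      case (Cons l u)
      then have "word_index 0 w = word_index 1 u" using True by (auto simp: convergent_word_def)
      then show ?thesis using hd_ge[of 1 u] by (simp add: numeral_2_eq_2)
    qed simp
    then show ?thesis using True pos by (auto simp: zeta_word_def admissible_def intro!: MZV_mzv)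
  qed (simp add: zeta_word_def MZV_0)
qed

lemma Phi_KZ_MZV: "ncoeff Phi_KZ w \<in> MZV"
proof -
  have sum_MZV: "(\<And>i. i \<in> S \<Longrightarrow> complex_of_real (f i) \<in> MZV) \<Longrightarrow> of_real (sum f S) \<in> MZV"
    for f :: "nat \<Rightarrow> real" and S
    by (induction S rule: infinite_finite_induct) (auto intro: MZV_0 MZV_add)
  have list_MZV: "complex_of_real (sum_list (map zeta_word us)) \<in> MZV" for us
    by (induction us) (auto intro: MZV_0 MZV_add zeta_word_MZV)
  have sign_MZV: "complex_of_real ((-1) ^ n) \<in> MZV" for n
    by (cases "even n") (auto intro: MZV_1 MZV_uminus)
  show ?thesis
    unfolding Phi_KZ_def zeta_reg_def Let_def
    by (simp only: Abs_ncs_inverse UNIV_I of_real_mult)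
       (intro MZV_mult sum_MZV; (rule sign_MZV | simp only: of_real_mult, intro MZV_mult sign_MZV list_MZV))
qed

section \<open>The automorphism \<open>\<sigma>\<close> and the section \<open>\<Gamma>\<close>\<close>

text \<open>
  An automorphism \<open>\<phi>\<close> of \<^term>\<open>f2\<close> acts on the group \<open>exp f2\<close> by \<open>\<phi> (e\<^sup>u) = e\<^bsup>\<phi> u\<^esup>\<close>.
\<close>

definition is_sigma :: "((letter_ab, complex) ncs \<Rightarrow> (letter_ab, complex) ncs) \<Rightarrow> bool" where
  "is_sigma \<sigma> \<longleftrightarrow>
     continuous_f2_automorphism \<sigma> \<and>
     nexp (\<sigma> t01) = eval_xy Phi_KZ t01 t12 * nexp t01 * ninverse (eval_xy Phi_KZ t01 t12) \<and>
     nexp (\<sigma> gen_b) = nexp (nscale (of_real pi * \<i>) t12) * eval_xy Phi_KZ t02 t12 * nexp gen_b *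
       ninverse (eval_xy Phi_KZ t01 t12)"

definition is_Gamma :: "(letter_xy, 'r::comm_rat_algebra) ncs \<Rightarrow>
    ((letter_ab, 'r) ncs \<Rightarrow> (letter_ab, 'r) ncs) \<Rightarrow> bool" where
  "is_Gamma \<Psi> \<gamma> \<longleftrightarrow>
     continuous_f2_automorphism \<gamma> \<and>
     \<gamma> t01 = eval_xy \<Psi> t01 t12 * t01 * ninverse (eval_xy \<Psi> t01 t12) \<and>
     \<gamma> gen_b = nlog (eval_xy \<Psi> t02 t12 * nexp gen_b * ninverse (eval_xy \<Psi> t01 t12))"

end

theory Submission
  imports Defs
begin

text \<open>
  Since \<open>t\<^sub>0\<^sub>1 = Ber\<^sub>b(-a)\<close>, the generator \<open>a\<close> is recovered as \<open>a = - ((e\<^sup>X - 1) / X)(ad b) t\<^sub>0\<^sub>1\<close>, a convergent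
  series of iterated brackets, so every continuous automorphism sends \<open>a\<close> to the same series
  in the images of \<open>b\<close> and \<open>t\<^sub>0\<^sub>1\<close>.  As \<open>exp\<close> is injective on series without constant term, the
  defining equations of \<open>\<sigma>\<close> can be solved for \<open>\<sigma>(t\<^sub>0\<^sub>1)\<close> and \<open>\<sigma>(b)\<close>; they become those of
  \<open>\<Gamma>\<close>, except for the factor \<open>exp (\<pi> i t\<^sub>1\<^sub>2)\<close>.  Reduction of coefficients is a ring homomorphism
  on series over \<open>Z[2 \<pi> i]\<close>, so it commutes with all series involved, and it sends this
  factor to \<open>1\<close>.
\<close>

section \<open>Coefficients and orders of noncommutative series\<close>

lemma ncoeff_Abs [simp]: "ncoeff (Abs_ncs f) w = f w"
  by (simp add: Abs_ncs_inverse)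

lemmas ncoeff_simps [simp] =
  zero_ncs.rep_eq one_ncs.rep_eq plus_ncs.rep_eq minus_ncs.rep_eq uminus_ncs.rep_eq

lemma ncoeff_times: "ncoeff (f * g) w = (\<Sum>k=0..length w. ncoeff f (take k w) * ncoeff g (drop k w))"
  by (simp add: times_ncs.rep_eq)

lemma ncoeff_nscale [simp]: "ncoeff (nscale c f) w = c * ncoeff f w"
  by (simp add: nscale_def)

lemma ncoeff_nletter [simp]: "ncoeff (nletter l) w = (if w = [l] then 1 else 0)"
  by (simp add: nletter_def)

lemma ncoeff_sum [simp]: "ncoeff (sum f S) w = (\<Sum>i\<in>S. ncoeff (f i) w)"
  by (induction S rule: infinite_finite_induct) auto

lemma rat_hom_0 [simp]: "rat_hom 0 = (0 :: 'r::comm_rat_algebra)"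
  using rat_hom_add[of 0 0, where 'a = 'r] by simp

lemma rat_hom_sum: "rat_hom (sum f S) = (\<Sum>i\<in>S. rat_hom (f i) :: 'r::comm_rat_algebra)"
  by (induction S rule: infinite_finite_induct) (auto simp: rat_hom_add)

declare rat_hom_1 [simp]

lemma nscale_mult_left: "nscale c f * g = nscale c (f * g)"
  by (rule ncs_eqI) (simp add: ncoeff_times sum_distrib_left mult.assoc)

lemma nscale_mult_right: "f * nscale c g = nscale c (f * g)"
  by (rule ncs_eqI) (simp add: ncoeff_times sum_distrib_left mult.left_commute)

lemma nscale_diff: "nscale c (f - g) = nscale c f - nscale c g"
  by (rule ncs_eqI) (simp add: right_diff_distrib)

lemma ord_ge_0 [simp]: "ord_ge 0 f"
  by (simp add: ord_ge_def)

lemma ord_ge_zero [simp]: "ord_ge n 0"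
  by (simp add: ord_ge_def)

lemma ord_ge_mono: "ord_ge n f \<Longrightarrow> m \<le> n \<Longrightarrow> ord_ge m f"
  by (auto simp: ord_ge_def)

lemma ord_ge_add: "ord_ge n f \<Longrightarrow> ord_ge n g \<Longrightarrow> ord_ge n (f + g)"
  by (auto simp: ord_ge_def)

lemma ord_ge_diff: "ord_ge n f \<Longrightarrow> ord_ge n g \<Longrightarrow> ord_ge n (f - g)"
  by (auto simp: ord_ge_def)

lemma ord_ge_nscale: "ord_ge n f \<Longrightarrow> ord_ge n (nscale c f)"
  by (auto simp: ord_ge_def)

lemma ord_ge_times:
  assumes "ord_ge m f" "ord_ge n g" shows "ord_ge (m + n) (f * g)"
  unfolding ord_ge_def
proof (intro allI impI)
  fix w :: "'a list" assume w: "length w < m + n"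
  have "ncoeff f (take k w) * ncoeff g (drop k w) = 0" if "k \<le> length w" for k
  proof (cases "k < m")
    case True
    then show ?thesis using assms(1) that by (simp add: ord_ge_def)
  next
    case False
    then show ?thesis using assms(2) that w by (simp add: ord_ge_def)
  qed
  then show "ncoeff (f * g) w = 0" by (simp add: ncoeff_times)
qed

lemma ord_ge_bracket: "ord_ge m f \<Longrightarrow> ord_ge n g \<Longrightarrow> ord_ge (m + n) (bracket f g)"
  using ord_ge_times[of m f n g] ord_ge_times[of n g m f]
  by (simp add: bracket_def ord_ge_diff add.commute)

text \<open>The degree topology is Hausdorff. Identities between infinite series are checked through
  truncations in this way.\<close>

lemma eq_if_ord_ge_diff:
  assumes "\<And>n. ord_ge n (f - g)" shows "f = g"
proof (rule ncs_eqI)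
  fix w
  show "ncoeff f w = ncoeff g w"
    using assms[of "Suc (length w)"] by (simp add: ord_ge_def)
qed

lemma ord_ge_nletter: "ord_ge 1 (nletter l)"
  by (simp add: ord_ge_def)

section \<open>Power series in an operator that raises the order\<close>

text \<open>The limit of the partial sums whenever \<open>s n\<close> has order at least
  \<open>n\<close>: the terms left out at a word then vanish there.\<close>

definition series_sum :: "(nat \<Rightarrow> ('l, 'r::comm_rat_algebra) ncs) \<Rightarrow> ('l, 'r) ncs" where
  "series_sum s = Abs_ncs (\<lambda>w. \<Sum>n\<le>length w. ncoeff (s n) w)"

lemma series_sum_ord_ge:
  assumes "\<And>n. ord_ge n (s n)"
  shows "ord_ge (Suc N) (series_sum s - (\<Sum>n\<le>N. s n))"
  unfolding ord_ge_def
proof (intro allI impI)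
  fix w :: "'a list" assume w: "length w < Suc N"
  have "(\<Sum>n\<le>N. ncoeff (s n) w) = (\<Sum>n\<le>length w. ncoeff (s n) w)"
    using w assms by (intro sum.mono_neutral_right) (auto simp: ord_ge_def)
  then show "ncoeff (series_sum s - (\<Sum>n\<le>N. s n)) w = 0"
    by (simp add: series_sum_def)
qed

text \<open>An additive map that does not lower orders is continuous for the degree topology, so it
  passes through the limit.\<close>

lemma additive_series_sum:
  assumes T: "Modules.additive T" and ord: "\<And>n f. ord_ge n f \<Longrightarrow> ord_ge n (T f)"
    and s: "\<And>n. ord_ge n (s n)"
  shows "T (series_sum s) = series_sum (\<lambda>n. T (s n))"
proof (rule eq_if_ord_ge_diff)
  fix N
  have "ord_ge (Suc N) (T (series_sum s) - (\<Sum>n\<le>N. T (s n)))"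
    using ord[OF series_sum_ord_ge[of s N, OF s]]
    by (simp add: additive.diff[OF T] additive.sum[OF T])
  \<comment> \<open>Both sides agree with the same partial sum up to order
    \<open>Suc N\<close>.\<close>
  from ord_ge_diff[OF this series_sum_ord_ge[of "\<lambda>n. T (s n)" N, OF ord[OF s]]]
  show "ord_ge N (T (series_sum s) - series_sum (\<lambda>n. T (s n)))"
    by (auto intro: ord_ge_mono)
qed

text \<open>This is \<open>F(T) y\<close>. Taking \<open>T = bracket x\<close> gives
  \<open>fps_ad\<close>, and taking left multiplication by \<open>u\<close> with
  \<open>y = 1\<close> gives \<open>fps_at\<close>, so the calculus of power series is developed
  once for both.\<close>

definition operator_series ::
  "rat fps \<Rightarrow> (('l, 'r::comm_rat_algebra) ncs \<Rightarrow> ('l, 'r) ncs) \<Rightarrow> ('l, 'r) ncs \<Rightarrow> ('l, 'r) ncs" where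
  "operator_series F T y = series_sum (\<lambda>n. nscale (rat_hom (fps_nth F n)) ((T ^^ n) y))"

lemma ncoeff_operator_series:
  "ncoeff (operator_series F T y) w = (\<Sum>n\<le>length w. rat_hom (fps_nth F n) * ncoeff ((T ^^ n) y) w)"
  by (simp add: operator_series_def series_sum_def)

lemma fps_ad_eq: "fps_ad F x y = operator_series F (bracket x) y"
  by (rule ncs_eqI) (simp add: fps_ad_def ncoeff_operator_series)

lemma funpow_times: "(((*) u) ^^ n) y = u ^ n * y" for u y :: "('l, 'r::comm_rat_algebra) ncs"
  by (induction n) (simp_all add: mult.assoc)

lemma fps_at_eq: "fps_at F u = operator_series F ((*) u) 1"
  by (rule ncs_eqI) (simp add: fps_at_def ncoeff_operator_series funpow_times)

locale raising_operator =
  fixes T :: "('l, 'r::comm_rat_algebra) ncs \<Rightarrow> ('l, 'r) ncs"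
  assumes add: "T (f + g) = T f + T g"
    and nscale: "T (nscale c f) = nscale c (T f)"
    and raises: "ord_ge n f \<Longrightarrow> ord_ge (Suc n) (T f)"
begin

lemma ord_ge_funpow: "ord_ge n f \<Longrightarrow> ord_ge (m + n) ((T ^^ m) f)"
  by (induction m) (auto intro: raises)

lemma additive_funpow: "Modules.additive (T ^^ m)"
  by standard (induction m, simp_all add: add)

lemma nscale_funpow: "(T ^^ m) (nscale c f) = nscale c ((T ^^ m) f)"
  by (induction m) (simp_all add: nscale)

lemma ord_ge_term: "ord_ge n (nscale c ((T ^^ n) f))"
  using ord_ge_nscale[OF ord_ge_funpow[of 0 f n]] by simp

text \<open>At a fixed word both sides are finite sums. The double sum over a square loses the terms
  whose total exponent exceeds the length of the word, and the remaining triangle, grouped by total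
  exponent, is the Cauchy product.\<close>

lemma operator_series_mult:
  "operator_series F T (operator_series G T y) = operator_series (F * G) T y"
proof (rule ncs_eqI)
  fix w :: "'l list"
  let ?L = "length w"
  define c where "c k = ncoeff ((T ^^ k) y) w" for k
  have c0: "c k = 0" if "?L < k" for k
    using ord_ge_funpow[of 0 y k] that by (simp add: c_def ord_ge_def)
  \<comment> \<open>The power of \<open>T\<close> is moved inside the inner series, being additive
    and never lowering the order.\<close>
  have pow: "ncoeff ((T ^^ n) (operator_series G T y)) w
      = (\<Sum>m\<le>?L. rat_hom (fps_nth G m) * c (n + m))" for n
  proof -
    have "(T ^^ n) (operator_series G T y)
        = series_sum (\<lambda>m. (T ^^ n) (nscale (rat_hom (fps_nth G m)) ((T ^^ m) y)))"
      unfolding operator_series_def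
      by (rule additive_series_sum[OF additive_funpow _ ord_ge_term])
         (auto intro: ord_ge_mono[OF ord_ge_funpow])
    then show ?thesis by (simp add: series_sum_def nscale_funpow c_def funpow_add)
  qed
  define g where "g i m = rat_hom (fps_nth F i) * rat_hom (fps_nth G m) * c (i + m)" for i m
  have g0: "g i m = 0" if "\<not> i + m \<le> ?L" for i m
    using c0[of "i + m"] that by (simp add: g_def)
  have "ncoeff (operator_series F T (operator_series G T y)) w = (\<Sum>n\<le>?L. \<Sum>m\<le>?L. g n m)"
    by (simp add: ncoeff_operator_series pow g_def sum_distrib_left mult.assoc)
  also have "\<dots> = (\<Sum>(n, m)\<in>{..?L} \<times> {..?L}. g n m)"
    by (simp add: sum.cartesian_product)
  \<comment> \<open>From the square to the triangle: the discarded terms vanish by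
    \<open>g0\<close>.\<close>
  also have "\<dots> = (\<Sum>(n, m)\<in>{(n, m). n + m \<le> ?L}. g n m)"
    by (intro sum.mono_neutral_right) (auto intro: g0)
  also have "\<dots> = (\<Sum>k\<le>?L. \<Sum>i\<le>k. g i (k - i))"
    by (rule sum.triangle_reindex_eq)
  also have "\<dots> = ncoeff (operator_series (F * G) T y) w"
    unfolding ncoeff_operator_series
    by (intro sum.cong refl)
       (simp add: g_def fps_mult_nth rat_hom_sum rat_hom_mult sum_distrib_right c_def
          atMost_atLeast0)
  finally show "ncoeff (operator_series F T (operator_series G T y)) w
      = ncoeff (operator_series (F * G) T y) w" .
qed

lemma operator_series_1: "operator_series 1 T y = y"
proof (rule ncs_eqI)
  fix w :: "'l list"
  have "ncoeff (operator_series 1 T y) w = (\<Sum>n\<le>length w. if n = 0 then ncoeff y w else 0)"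
    unfolding ncoeff_operator_series by (intro sum.cong) auto
  then show "ncoeff (operator_series 1 T y) w = ncoeff y w" by simp
qed

end

section \<open>Adjoint action and left multiplication; exponential, logarithm and inverse\<close>

lemma raising_operator_bracket:
  assumes "ord_ge 1 x" shows "raising_operator (bracket x)"
proof
  show "ord_ge n f \<Longrightarrow> ord_ge (Suc n) (bracket x f)" for n f
    using ord_ge_bracket[OF assms, of n f] by simp
qed (simp_all add: bracket_def algebra_simps nscale_mult_left nscale_mult_right nscale_diff)

lemma raising_operator_times:
  assumes "ord_ge 1 x" shows "raising_operator ((*) x)"
proof
  show "ord_ge n f \<Longrightarrow> ord_ge (Suc n) (x * f)" for n f
    using ord_ge_times[OF assms, of n f] by simp
qed (simp_all add: algebra_simps nscale_mult_right)

text \<open>Right multiplication by \<open>fps_at G u\<close> passes through the series of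
  \<open>F\<close>, which turns the product into the operator \<open>F(u)\<close> applied to
  \<open>G(u) 1\<close>. Then \<open>operator_series_mult\<close> applies.\<close>

lemma fps_at_mult:
  assumes "ord_ge 1 u" shows "fps_at (F * G) u = fps_at F u * fps_at G u"
proof -
  interpret raising_operator "(*) u" by (rule raising_operator_times[OF assms])
  have "fps_at F u * fps_at G u = operator_series F ((*) u) (fps_at G u)"
  proof -
    have "Modules.additive (\<lambda>f. f * fps_at G u)" by standard (simp add: distrib_right)
    then have "fps_at F u * fps_at G u
        = series_sum (\<lambda>n. nscale (rat_hom (fps_nth F n)) ((((*) u) ^^ n) 1) * fps_at G u)"
      unfolding fps_at_eq[of F] operator_series_def
      by (rule additive_series_sum) (auto intro: ord_ge_term dest: ord_ge_times[OF _ ord_ge_0])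
    then show ?thesis by (simp add: operator_series_def funpow_times nscale_mult_left)
  qed
  then show ?thesis by (simp add: fps_at_eq[of G] fps_at_eq[of "F * G"] operator_series_mult)
qed

lemma fps_at_1: "ord_ge 1 u \<Longrightarrow> fps_at 1 u = 1"
  by (simp add: fps_at_eq raising_operator.operator_series_1 raising_operator_times)

lemma fps_at_X:
  assumes "ord_ge 1 u" shows "fps_at fps_X u = u"
proof (rule ncs_eqI)
  fix w :: "'a list"
  have "ncoeff (fps_at fps_X u) w = (\<Sum>n\<le>length w. if n = 1 then ncoeff u w else 0)"
    unfolding fps_at_def ncoeff_Abs by (intro sum.cong) auto
  also have "\<dots> = ncoeff u w"
    using assms by (cases w) (auto simp: ord_ge_def Suc_le_eq)
  finally show "ncoeff (fps_at fps_X u) w = ncoeff u w" .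
qed

lemma fps_at_diff: "fps_at (F - G) u = fps_at F u - fps_at G u"
proof (rule ncs_eqI)
  fix w :: "'a list"
  have "rat_hom (p - q) = (rat_hom p - rat_hom q :: 'b)" for p q
    using rat_hom_add[of "p - q" q, where 'a = 'b] by (simp add: eq_diff_eq)
  then show "ncoeff (fps_at (F - G) u) w = ncoeff (fps_at F u - fps_at G u) w"
    by (simp add: fps_at_def left_diff_distrib sum_subtractf)
qed

lemma fps_at_power: "ord_ge 1 u \<Longrightarrow> fps_at F u ^ n = fps_at (F ^ n) u"
  by (induction n) (simp_all add: fps_at_1 fps_at_mult)

lemma fps_at_compose:
  assumes u: "ord_ge 1 u" and G: "fps_nth G 0 = 0"
  shows "fps_at F (fps_at G u) = fps_at (F oo G) u"
proof (rule ncs_eqI)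
  fix w :: "'a list"
  let ?L = "length w"
  have "ncoeff (fps_at F (fps_at G u)) w
      = (\<Sum>n\<le>?L. \<Sum>m\<le>?L. rat_hom (fps_nth F n * fps_nth (G ^ n) m) * ncoeff (u ^ m) w)"
    unfolding fps_at_def[of F] fps_at_power[OF u]
    by (simp add: fps_at_def sum_distrib_left rat_hom_mult mult.assoc)
  also have "\<dots> = (\<Sum>m\<le>?L. (\<Sum>n\<le>?L. rat_hom (fps_nth F n * fps_nth (G ^ n) m)) * ncoeff (u ^ m) w)"
    by (subst sum.swap) (simp add: sum_distrib_right)
  also have "\<dots> = (\<Sum>m\<le>?L. rat_hom (fps_nth (F oo G) m) * ncoeff (u ^ m) w)"
  proof (intro sum.cong refl arg_cong2[where f = "(*)"])
    fix m assume "m \<in> {..?L}"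
    \<comment> \<open>Since \<open>G\<close> has no constant term, \<open>G ^ n\<close> starts in
      degree \<open>n\<close>, so only the indices up to \<open>m\<close>, which is at most
      \<open>?L\<close>, contribute.\<close>
    then have "(\<Sum>n\<le>?L. fps_nth F n * fps_nth (G ^ n) m) = fps_nth (F oo G) m"
      unfolding fps_compose_nth
      by (intro sum.mono_neutral_right) (auto simp: startsby_zero_power_prefix[OF G])
    then show "(\<Sum>n\<le>?L. rat_hom (fps_nth F n * fps_nth (G ^ n) m)) = (rat_hom (fps_nth (F oo G) m) :: 'b)"
      by (simp flip: rat_hom_sum)
  qed
  finally show "ncoeff (fps_at F (fps_at G u)) w = ncoeff (fps_at (F oo G) u) w"
    by (simp add: fps_at_def)
qed

lemma fps_ln_compose_exp: "fps_ln 1 oo (fps_exp 1 - 1) = (fps_X :: rat fps)"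
  by (simp add: fps_ln_fps_exp_inv fps_inv)

text \<open>The logarithm series is the compositional inverse of \<open>fps_exp 1 - 1\<close>. Hence
  \<open>nexp\<close> is injective on series without constant term, which allows an equation between
  exponentials to be solved.\<close>

lemma nlog_nexp:
  assumes "ord_ge 1 u" shows "nlog (nexp u) = u"
proof -
  have "nexp u - 1 = fps_at (fps_exp 1 - 1) u"
    by (simp add: nexp_def fps_at_diff fps_at_1[OF assms])
  then show ?thesis
    using assms by (simp add: nlog_def fps_at_compose fps_ln_compose_exp fps_at_X)
qed

lemma nexp_0: "nexp 0 = 1"
proof (rule ncs_eqI)
  fix w :: "'a list"
  have "(0 :: ('a, 'b) ncs) ^ n = (if n = 0 then 1 else 0)" for n
    by (cases n) (simp_all)
  then have "ncoeff (nexp (0 :: ('a, 'b) ncs)) w = (\<Sum>n\<le>length w. if n = 0 then ncoeff 1 w else 0)"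
    unfolding nexp_def fps_at_def ncoeff_Abs by (intro sum.cong) auto
  then show "ncoeff (nexp 0) w = ncoeff (1 :: ('a, 'b) ncs) w" by simp
qed

text \<open>Conjugation is multiplicative, so it can be applied to each power of \<open>u\<close>,
  and it is continuous. For the exponential this turns a conjugate of \<open>nexp t01\<close> into
  the exponential of a conjugate of \<open>t01\<close>.\<close>

lemma fps_at_conjugate:
  assumes u: "ord_ge 1 u" and hg: "h * g = 1" and gh: "g * h = 1"
  shows "fps_at F (g * u * h) = g * fps_at F u * h"
proof -
  interpret raising_operator "(*) u" by (rule raising_operator_times[OF u])
  have pow: "(g * u * h) ^ n = g * u ^ n * h" for n
  proof (induction n)
    case (Suc n)
    have "(g * u * h) ^ Suc n = g * u * (h * g) * u ^ n * h" using Suc by (simp add: mult.assoc)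
    then show ?case using hg by (simp add: mult.assoc)
  qed (simp add: gh)
  have "Modules.additive (\<lambda>f. g * f * h)" by standard (simp add: algebra_simps)
  then have "g * fps_at F u * h
      = series_sum (\<lambda>n. g * nscale (rat_hom (fps_nth F n)) ((((*) u) ^^ n) 1) * h)"
    unfolding fps_at_eq operator_series_def
    by (rule additive_series_sum)
       (use ord_ge_times[OF ord_ge_times[OF ord_ge_0] ord_ge_0] in \<open>auto intro: ord_ge_term\<close>)
  also have "\<dots> = fps_at F (g * u * h)"
    unfolding fps_at_eq operator_series_def
    by (simp add: funpow_times nscale_mult_left nscale_mult_right pow)
  finally show ?thesis ..
qed

lemma ninverse_eqI:
  assumes "g * h = 1" "h * g = 1" shows "ninverse g = h"
  unfolding ninverse_def
proof (rule the_equality)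
  fix h' assume "g * h' = 1 \<and> h' * g = 1"
  then have "h' = h' * (g * h)" using assms by simp
  also have "\<dots> = h" using \<open>g * h' = 1 \<and> h' * g = 1\<close> by (simp flip: mult.assoc)
  finally show "h' = h" .
qed (use assms in simp)

text \<open>The geometric series in \<open>1 - g\<close>. Besides showing that the inverse exists,
  it writes the inverse as a power series with rational coefficients, a form that reduction is able
  to handle.\<close>

lemma ninverse_eq_fps_at:
  assumes "ncoeff g [] = 1"
  shows "ninverse g = fps_at (inverse (1 - fps_X)) (1 - g)" (is "_ = ?h")
    and "g * ninverse g = 1" and "ninverse g * g = 1"
proof -
  have u: "ord_ge 1 (1 - g)" using assms by (simp add: ord_ge_def)
  have g: "g = fps_at (1 - fps_X) (1 - g)" by (simp add: fps_at_diff fps_at_1[OF u] fps_at_X[OF u])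
  have "(1 - fps_X) * inverse (1 - fps_X) = (1 :: rat fps)"
    by (rule inverse_mult_eq_1') simp
  then have "g * ?h = 1" "?h * g = 1"
    using fps_at_mult[OF u, of "1 - fps_X" "inverse (1 - fps_X)"]
      fps_at_mult[OF u, of "inverse (1 - fps_X)" "1 - fps_X"] g fps_at_1[OF u]
    by (simp_all add: mult.commute)
  moreover from this show "ninverse g = ?h" by (rule ninverse_eqI)
  ultimately show "g * ninverse g = 1" "ninverse g * g = 1" by simp_all
qed

section \<open>Continuous automorphisms\<close>

lemma ord_ge_gen: "ord_ge 1 gen_a" "ord_ge 1 gen_b"
  by (simp_all add: gen_a_def gen_b_def ord_ge_nletter[unfolded One_nat_def])

lemma ord_ge_lie_polys: "f \<in> lie_polys \<Longrightarrow> ord_ge 1 f"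
proof (induction rule: lie_polys.induct)
  case (lie_bracket f g)
  from ord_ge_bracket[OF this(3,4)] show ?case by (rule ord_ge_mono) simp
qed (auto intro: ord_ge_gen[unfolded One_nat_def] ord_ge_add ord_ge_nscale)

lemma ord_ge_f2:
  assumes "f \<in> f2" shows "ord_ge 1 f"
proof -
  obtain p where "p \<in> lie_polys" "ord_ge 1 (f - p)" using assms by (auto simp: f2_def)
  then show ?thesis using ord_ge_add[of 1 "f - p" p] ord_ge_lie_polys by auto
qed

section \<open>Closure properties of the completed free Lie algebra\<close>

lemma f2_closed:
  assumes "\<And>n. \<exists>g\<in>f2. ord_ge n (f - g)" shows "f \<in> f2"
  unfolding f2_def
proof (intro CollectI allI)
  fix n
  obtain g p where "ord_ge n (f - g)" "p \<in> lie_polys" "ord_ge n (g - p)"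
    using assms[of n] unfolding f2_def by blast
  then show "\<exists>p\<in>lie_polys. ord_ge n (f - p)"
    using ord_ge_add[of n "f - g" "g - p"] by auto
qed

lemma lie_polys_f2: "p \<in> lie_polys \<Longrightarrow> p \<in> f2"
  by (auto simp: f2_def intro!: bexI[of _ p])

lemma gen_f2: "gen_a \<in> f2" "gen_b \<in> f2" and zero_f2: "0 \<in> f2"
  by (auto intro: lie_polys_f2 lie_polys.intros)

lemma nscale_f2:
  assumes "f \<in> f2" shows "nscale c f \<in> f2"
  unfolding f2_def
proof (intro CollectI allI)
  fix n
  obtain p where "p \<in> lie_polys" "ord_ge n (f - p)" using assms by (auto simp: f2_def)
  then show "\<exists>p\<in>lie_polys. ord_ge n (nscale c f - p)"
    by (intro bexI[of _ "nscale c p"]) (auto simp flip: nscale_diff intro: ord_ge_nscale lie_scale)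
qed

lemma add_f2:
  assumes "f \<in> f2" "g \<in> f2" shows "f + g \<in> f2"
  unfolding f2_def
proof (intro CollectI allI)
  fix n
  obtain p q where "p \<in> lie_polys" "ord_ge n (f - p)" "q \<in> lie_polys" "ord_ge n (g - q)"
    using assms unfolding f2_def by blast
  then show "\<exists>p\<in>lie_polys. ord_ge n (f + g - p)"
    using ord_ge_add[of n "f - p" "g - q"]
    by (intro bexI[of _ "p + q"]) (auto simp: algebra_simps intro: lie_add)
qed

lemma bracket_f2:
  assumes "f \<in> f2" "g \<in> f2" shows "bracket f g \<in> f2"
  unfolding f2_def
proof (intro CollectI allI)
  fix n
  obtain p q where *: "p \<in> lie_polys" "ord_ge n (f - p)" "q \<in> lie_polys" "ord_ge n (g - q)"
    using assms unfolding f2_def by blast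
  \<comment> \<open>Bilinearity, arranged so that each summand contains one approximation error of
    order at least \<open>n\<close>.\<close>
  have "bracket f g - bracket p q = bracket (f - p) g + bracket p (g - q)"
    by (simp add: bracket_def algebra_simps)
  then have "ord_ge n (bracket f g - bracket p q)"
    using ord_ge_bracket[OF *(2) ord_ge_0] ord_ge_bracket[OF ord_ge_0 *(4)]
    by (simp add: ord_ge_add)
  then show "\<exists>p\<in>lie_polys. ord_ge n (bracket f g - p)"
    using * by (auto intro: lie_bracket)
qed

lemma uminus_f2:
  assumes "f \<in> f2" shows "- f \<in> f2"
proof -
  have "nscale (- 1) f = - f" by (rule ncs_eqI) simp
  then show ?thesis using nscale_f2[OF assms, of "- 1"] by simp
qed

lemma sum_f2: "(\<And>i. i \<in> S \<Longrightarrow> s i \<in> f2) \<Longrightarrow> sum s S \<in> f2"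
  by (induction S rule: infinite_finite_induct) (auto intro: zero_f2 add_f2)

lemma funpow_bracket_f2: "x \<in> f2 \<Longrightarrow> y \<in> f2 \<Longrightarrow> (bracket x ^^ n) y \<in> f2"
  by (induction n) (auto intro: bracket_f2)

lemma series_sum_f2:
  assumes "\<And>n. ord_ge n (s n)" "\<And>n. s n \<in> f2" shows "series_sum s \<in> f2"
proof (rule f2_closed)
  fix n
  show "\<exists>g\<in>f2. ord_ge n (series_sum s - g)"
    using series_sum_ord_ge[of s n, OF assms(1)] assms(2)
    by (intro bexI[of _ "sum s {..n}"]) (auto intro: sum_f2 ord_ge_mono)
qed

lemma fps_ad_f2: "x \<in> f2 \<Longrightarrow> y \<in> f2 \<Longrightarrow> fps_ad F x y \<in> f2"
  unfolding fps_ad_eq operator_series_def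
  by (intro series_sum_f2 nscale_f2 funpow_bracket_f2
        raising_operator.ord_ge_term[OF raising_operator_bracket] ord_ge_f2)

lemma t01_f2: "t01 \<in> f2"
  unfolding t01_def Ber_def by (intro fps_ad_f2 uminus_f2 gen_f2)

text \<open>The partial sums are finite Lie expressions, so \<phi> maps them to the partial sums for
  the images; continuity at the limit carries this over to the whole series.\<close>

lemma continuous_f2_automorphism_fps_ad:
  assumes \<phi>: "continuous_f2_automorphism \<phi>" and x: "x \<in> f2" and y: "y \<in> f2"
  shows "\<phi> (fps_ad F x y) = fps_ad F (\<phi> x) (\<phi> y)"
proof (rule eq_if_ord_ge_diff)
  fix n
  have \<phi>_f2: "\<phi> f \<in> f2" if "f \<in> f2" for f
    using \<phi> that by (auto simp: continuous_f2_automorphism_def bij_betw_def)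
  have add: "\<phi> (f + g) = \<phi> f + \<phi> g" and scale: "\<phi> (nscale c f) = nscale c (\<phi> f)"
    and brk: "\<phi> (bracket f g) = bracket (\<phi> f) (\<phi> g)" if "f \<in> f2" "g \<in> f2" for c f g
    using \<phi> that by (auto simp: continuous_f2_automorphism_def)
  have zero: "\<phi> 0 = 0" using add[OF zero_f2 zero_f2] by simp
  have sum: "\<phi> (sum s S) = (\<Sum>i\<in>S. \<phi> (s i))" if "\<And>i. s i \<in> f2" for s :: "nat \<Rightarrow> _" and S
    by (induction S rule: infinite_finite_induct) (auto simp: zero add sum_f2 that)
  have pow: "\<phi> ((bracket x ^^ k) y) = (bracket (\<phi> x) ^^ k) (\<phi> y)" for k
    by (induction k) (auto simp: brk x y funpow_bracket_f2)
  define s where "s k = nscale (rat_hom (fps_nth F k)) ((bracket x ^^ k) y)" for k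
  define s' where "s' k = nscale (rat_hom (fps_nth F k)) ((bracket (\<phi> x) ^^ k) (\<phi> y))" for k
  have s_f2: "s k \<in> f2" for k
    unfolding s_def by (intro nscale_f2 funpow_bracket_f2 x y)
  have \<phi>s: "\<phi> (s k) = s' k" for k
    unfolding s_def s'_def by (simp add: scale[OF _ zero_f2] pow funpow_bracket_f2 x y)
  have ord: "ord_ge k (s k)" "ord_ge k (s' k)" for k
    unfolding s_def s'_def
    by (intro raising_operator.ord_ge_term[OF raising_operator_bracket] ord_ge_f2 \<phi>_f2 x y)+
  have S: "fps_ad F x y = series_sum s" "fps_ad F (\<phi> x) (\<phi> y) = series_sum s'"
    by (simp_all add: fps_ad_eq operator_series_def s_def[abs_def] s'_def[abs_def])
  obtain m where m: "\<And>g. g \<in> f2 \<Longrightarrow> ord_ge m (g - series_sum s) \<Longrightarrow> ord_ge n (\<phi> g - \<phi> (series_sum s))"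
    using \<phi> series_sum_f2[of s, OF ord(1) s_f2]
    unfolding continuous_f2_automorphism_def f2_continuous_def by blast
  \<comment> \<open>At least \<open>m\<close>, so that the partial sum falls under the continuity
    estimate; at least \<open>n\<close>, so that the tail of the image series is negligible.\<close>
  define N where "N = max m n"
  have "ord_ge m (series_sum s - sum s {..N})"
    using series_sum_ord_ge[of s N, OF ord(1)] by (rule ord_ge_mono) (simp add: N_def)
  then have "ord_ge m (sum s {..N} - series_sum s)"
    using ord_ge_diff[OF ord_ge_zero] by fastforce
  then have "ord_ge n (sum s' {..N} - \<phi> (series_sum s))"
    using m[OF sum_f2[of "{..N}" s, OF s_f2]] by (simp add: sum s_f2 \<phi>s)
  moreover have "ord_ge n (series_sum s' - sum s' {..N})"
    using series_sum_ord_ge[of s' N, OF ord(2)] by (rule ord_ge_mono) (simp add: N_def)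
  ultimately have "ord_ge n (0 - ((series_sum s' - sum s' {..N}) + (sum s' {..N} - \<phi> (series_sum s))))"
    by (intro ord_ge_diff[OF ord_ge_zero] ord_ge_add)
  then show "ord_ge n (\<phi> (fps_ad F x y) - fps_ad F (\<phi> x) (\<phi> y))"
    by (simp add: S)
qed

text \<open>The shifted series is \<open>(e^X - 1)/X\<close>, the inverse of the Bernoulli series in
  \<open>Ber\<close>. Applying it to \<open>ad b\<close> therefore undoes the definition of
  \<open>t01\<close> and leaves \<open>- gen_a\<close>.\<close>

lemma gen_a_eq:
  "(gen_a :: (letter_ab, 'r::comm_rat_algebra) ncs)
    = - fps_ad (fps_shift 1 (fps_exp 1 - 1)) gen_b t01"
proof -
  let ?F = "fps_X / (fps_exp 1 - 1) :: rat fps" and ?G = "fps_shift 1 (fps_exp 1 - 1) :: rat fps"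
  let ?E = "fps_exp 1 - 1 :: rat fps"
  have E: "fps_nth ?E 1 = 1" "fps_nth ?E 0 = 0" by simp_all
  then have E0: "?E \<noteq> 0" and deg: "subdegree ?E = 1"
    by (metis fps_zero_nth zero_neq_one, intro subdegreeI) auto
  \<comment> \<open>Divisor and dividend both have subdegree 1, so the quotient \<open>?F\<close> is
    exact.\<close>
  then have "?E dvd fps_X" by (subst fps_dvd_iff) auto
  then have "?F * ?E = fps_X" by simp
  moreover have "?E = ?G * fps_X"
    by (rule fps_ext) simp
  ultimately have "?G * ?F * fps_X = 1 * fps_X" by (metis mult.assoc mult.commute mult_1)
  then have GF: "?G * ?F = 1" by (metis mult_right_cancel fps_X_neq_zero)
  interpret raising_operator "bracket (gen_b :: (letter_ab, 'r) ncs)"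
    by (rule raising_operator_bracket[OF ord_ge_gen(2)])
  have "fps_ad ?G gen_b t01 = - (gen_a :: (letter_ab, 'r) ncs)"
    unfolding t01_def Ber_def fps_ad_eq operator_series_mult GF operator_series_1 ..
  then show ?thesis by (simp only: minus_minus)
qed

text \<open>The formula does not mention \<phi> except through its values at \<open>gen_b\<close>
  and \<open>t01\<close>, so two automorphisms need to be compared only there.\<close>

lemma continuous_f2_automorphism_gen_a:
  assumes "continuous_f2_automorphism \<phi>"
  shows "\<phi> gen_a = - fps_ad (fps_shift 1 (fps_exp 1 - 1)) (\<phi> gen_b) (\<phi> t01)"
proof -
  let ?s = "fps_ad (fps_shift 1 (fps_exp 1 - 1)) gen_b t01"
  have s: "?s \<in> f2" by (intro fps_ad_f2 gen_f2 t01_f2)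
  have add: "\<phi> (f + g) = \<phi> f + \<phi> g" if "f \<in> f2" "g \<in> f2" for f g
    using assms that by (auto simp: continuous_f2_automorphism_def)
  have "\<phi> 0 = 0" using add[OF zero_f2 zero_f2] by simp
  then have "\<phi> ?s + \<phi> (- ?s) = 0" using add[OF s uminus_f2[OF s]] by simp
  then have "\<phi> (- ?s) = - \<phi> ?s" by (simp add: minus_unique)
  then show ?thesis
    using gen_a_eq continuous_f2_automorphism_fps_ad[OF assms gen_f2(2) t01_f2] by metis
qed

section \<open>Reduction modulo \<open>2 \<pi> i\<close>\<close>

text \<open>The series on which coefficientwise reduction is meaningful: \<open>red\<close> is a
  ring homomorphism only on \<open>MZV_2pii\<close>.\<close>

definition integral_series :: "('l, complex) ncs \<Rightarrow> bool" where
  "integral_series f \<longleftrightarrow> (\<forall>w. ncoeff f w \<in> MZV_2pii)"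

lemma ncoeff_reduce [simp]: "ncoeff (reduce_series f) w = red (ncoeff f w)"
  by (simp add: reduce_series_def)

lemma rat_MZV_2pii: "of_rat q \<in> MZV_2pii"
  by (intro MZV_2pii_base MZV_rat)

lemma red_0_1 [simp]: "red 0 = 0" "red 1 = 1"
  using red_rat[of 0] red_rat[of 1] by simp_all

lemma MZV_2pii_0_1 [simp]: "0 \<in> MZV_2pii" "1 \<in> MZV_2pii"
  using rat_MZV_2pii[of 0] rat_MZV_2pii[of 1] by simp_all

lemma red_uminus:
  assumes "z \<in> MZV_2pii" shows "red (- z) = - red z"
proof -
  have "red z + red (- z) = 0"
    using red_add[OF assms MZV_2pii_uminus[OF assms]] by simp
  then show ?thesis by (simp add: minus_unique)
qed

lemma MZV_2pii_sum: "(\<And>i. i \<in> S \<Longrightarrow> f i \<in> MZV_2pii) \<Longrightarrow> sum f S \<in> MZV_2pii"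
  by (induction S rule: infinite_finite_induct) (auto intro: MZV_2pii_add)

lemma red_sum: "(\<And>i. i \<in> S \<Longrightarrow> f i \<in> MZV_2pii) \<Longrightarrow> red (sum f S) = (\<Sum>i\<in>S. red (f i))"
  by (induction S rule: infinite_finite_induct) (auto simp: red_add MZV_2pii_sum)

text \<open>The collections work in tandem: the rules in \<open>reduce_simps\<close> move reduction
  inwards, and those in \<open>reduce_intros\<close> discharge their integrality conditions.\<close>

named_theorems reduce_intros
named_theorems reduce_simps

lemma integral_series_0 [reduce_intros]: "integral_series 0"
  and integral_series_1 [reduce_intros]: "integral_series 1"
  and integral_series_nletter [reduce_intros]: "integral_series (nletter l)"
  by (simp_all add: integral_series_def)

lemma integral_series_add [reduce_intros]:
  "integral_series f \<Longrightarrow> integral_series g \<Longrightarrow> integral_series (f + g)"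
  by (simp add: integral_series_def MZV_2pii_add)

lemma integral_series_uminus [reduce_intros]: "integral_series f \<Longrightarrow> integral_series (- f)"
  by (simp add: integral_series_def MZV_2pii_uminus)

lemma integral_series_diff [reduce_intros]:
  "integral_series f \<Longrightarrow> integral_series g \<Longrightarrow> integral_series (f - g)"
  using integral_series_add[OF _ integral_series_uminus] by fastforce

lemma integral_series_times [reduce_intros]:
  "integral_series f \<Longrightarrow> integral_series g \<Longrightarrow> integral_series (f * g)"
  by (simp add: integral_series_def ncoeff_times MZV_2pii_sum MZV_2pii_mult)

lemma integral_series_nscale [reduce_intros]:
  "c \<in> MZV_2pii \<Longrightarrow> integral_series f \<Longrightarrow> integral_series (nscale c f)"
  by (simp add: integral_series_def MZV_2pii_mult)

lemma integral_series_bracket [reduce_intros]: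
  "integral_series f \<Longrightarrow> integral_series g \<Longrightarrow> integral_series (bracket f g)"
  unfolding bracket_def by (intro reduce_intros)

lemma reduce_series_0 [reduce_simps]: "reduce_series 0 = 0"
  and reduce_series_1 [reduce_simps]: "reduce_series 1 = 1"
  and reduce_series_nletter [reduce_simps]: "reduce_series (nletter l) = nletter l"
  by (rule ncs_eqI; simp)+

lemma reduce_series_add [reduce_simps]:
  "integral_series f \<Longrightarrow> integral_series g \<Longrightarrow> reduce_series (f + g) = reduce_series f + reduce_series g"
  by (rule ncs_eqI) (simp add: integral_series_def red_add)

lemma reduce_series_uminus [reduce_simps]:
  "integral_series f \<Longrightarrow> reduce_series (- f) = - reduce_series f"
  by (rule ncs_eqI) (simp add: integral_series_def red_uminus)

lemma reduce_series_diff [reduce_simps]: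
  "integral_series f \<Longrightarrow> integral_series g \<Longrightarrow> reduce_series (f - g) = reduce_series f - reduce_series g"
  using reduce_series_add[OF _ integral_series_uminus] reduce_series_uminus by fastforce

lemma reduce_series_times [reduce_simps]:
  "integral_series f \<Longrightarrow> integral_series g \<Longrightarrow> reduce_series (f * g) = reduce_series f * reduce_series g"
  by (rule ncs_eqI) (simp add: integral_series_def ncoeff_times red_sum red_mult MZV_2pii_mult)

lemma reduce_series_nscale:
  "c \<in> MZV_2pii \<Longrightarrow> integral_series f \<Longrightarrow> reduce_series (nscale c f) = nscale (red c) (reduce_series f)"
  by (rule ncs_eqI) (simp add: integral_series_def red_mult)

lemma reduce_series_bracket [reduce_simps]:
  "integral_series f \<Longrightarrow> integral_series g \<Longrightarrow>
    reduce_series (bracket f g) = bracket (reduce_series f) (reduce_series g)"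
  unfolding bracket_def by (simp add: reduce_simps reduce_intros)

lemma reduce_power:
  assumes "integral_series f"
  shows "integral_series (f ^ n)" "reduce_series (f ^ n) = reduce_series f ^ n"
  by (induction n) (simp_all add: reduce_simps reduce_intros assms)

lemma reduce_funpow_bracket:
  assumes "integral_series x" "integral_series y"
  shows "integral_series ((bracket x ^^ n) y)"
    "reduce_series ((bracket x ^^ n) y) = (bracket (reduce_series x) ^^ n) (reduce_series y)"
  by (induction n) (simp_all add: reduce_simps reduce_intros assms)

lemma reduce_prod_list:
  assumes "\<And>l. integral_series (\<theta> l)"
  shows "integral_series (prod_list (map \<theta> w))"
    "reduce_series (prod_list (map \<theta> w)) = prod_list (map (\<lambda>l. reduce_series (\<theta> l)) w)"
  by (induction w) (simp_all add: reduce_simps reduce_intros assms)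

text \<open>In the second equation the left \<open>rat_hom\<close> takes values in
  \<open>complex\<close> and the right one in \<open>mzvbar\<close>. This is why power series with
  rational coefficients commute with reduction.\<close>

lemma rat_hom_complex_MZV_2pii: "rat_hom q \<in> MZV_2pii" and red_rat_hom: "red (rat_hom q) = rat_hom q"
  by (simp_all add: rat_hom_complex_def rat_MZV_2pii red_rat)

section \<open>Reduction of power series, substitutions and inverses\<close>

lemma integral_series_fps_at [reduce_intros]:
  assumes "integral_series u" shows "integral_series (fps_at F u)"
  using reduce_power(1)[OF assms]
  by (auto simp: integral_series_def fps_at_def intro!: MZV_2pii_sum MZV_2pii_mult rat_hom_complex_MZV_2pii)

lemma reduce_series_fps_at [reduce_simps]:
  assumes "integral_series u" shows "reduce_series (fps_at F u) = fps_at F (reduce_series u)"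
proof (rule ncs_eqI)
  fix w
  have "ncoeff (u ^ n) w \<in> MZV_2pii" for n
    using reduce_power(1)[OF assms] by (simp add: integral_series_def)
  then show "ncoeff (reduce_series (fps_at F u)) w = ncoeff (fps_at F (reduce_series u)) w"
    by (simp add: fps_at_def red_sum red_mult MZV_2pii_mult rat_hom_complex_MZV_2pii red_rat_hom
        flip: reduce_power(2)[OF assms])
qed

lemma integral_series_fps_ad [reduce_intros]:
  assumes "integral_series x" "integral_series y" shows "integral_series (fps_ad F x y)"
  using reduce_funpow_bracket(1)[OF assms]
  by (auto simp: integral_series_def fps_ad_def intro!: MZV_2pii_sum MZV_2pii_mult rat_hom_complex_MZV_2pii)

lemma reduce_series_fps_ad [reduce_simps]:
  assumes "integral_series x" "integral_series y"
  shows "reduce_series (fps_ad F x y) = fps_ad F (reduce_series x) (reduce_series y)"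
proof (rule ncs_eqI)
  fix w
  have "ncoeff ((bracket x ^^ n) y) w \<in> MZV_2pii" for n
    using reduce_funpow_bracket(1)[OF assms] by (simp add: integral_series_def)
  then show "ncoeff (reduce_series (fps_ad F x y)) w
      = ncoeff (fps_ad F (reduce_series x) (reduce_series y)) w"
    by (simp add: fps_ad_def red_sum red_mult MZV_2pii_mult rat_hom_complex_MZV_2pii red_rat_hom
        flip: reduce_funpow_bracket(2)[OF assms])
qed

lemma
  assumes "integral_series \<Psi>" "\<And>l. integral_series (\<theta> l)"
  shows integral_series_nsubst: "integral_series (nsubst \<Psi> \<theta>)"
    and reduce_series_nsubst:
      "reduce_series (nsubst \<Psi> \<theta>) = nsubst (reduce_series \<Psi>) (\<lambda>l. reduce_series (\<theta> l))"
proof -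
  have *: "ncoeff \<Psi> w \<in> MZV_2pii" "ncoeff (prod_list (map \<theta> w)) z \<in> MZV_2pii" for w z
    using assms(1) reduce_prod_list(1)[of \<theta> w, OF assms(2)] by (simp_all add: integral_series_def)
  show "integral_series (nsubst \<Psi> \<theta>)"
    by (simp add: integral_series_def nsubst_def MZV_2pii_sum MZV_2pii_mult *)
  show "reduce_series (nsubst \<Psi> \<theta>) = nsubst (reduce_series \<Psi>) (\<lambda>l. reduce_series (\<theta> l))"
    by (rule ncs_eqI)
       (simp add: nsubst_def red_sum red_mult MZV_2pii_mult * flip: reduce_prod_list(2)[of \<theta>, OF assms(2)])
qed

lemma
  assumes "integral_series \<Psi>" "integral_series u" "integral_series v"
  shows integral_series_eval_xy [reduce_intros]: "integral_series (eval_xy \<Psi> u v)"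
    and reduce_series_eval_xy [reduce_simps]:
      "reduce_series (eval_xy \<Psi> u v) = eval_xy (reduce_series \<Psi>) (reduce_series u) (reduce_series v)"
proof -
  have *: "integral_series (case_letter_xy u v l)" for l
    using assms by (cases l) auto
  show "integral_series (eval_xy \<Psi> u v)"
    unfolding eval_xy_def by (rule integral_series_nsubst[OF assms(1) *])
  have "(\<lambda>l. reduce_series (case_letter_xy u v l)) = case_letter_xy (reduce_series u) (reduce_series v)"
    by (rule ext) (simp split: letter_xy.split)
  then show "reduce_series (eval_xy \<Psi> u v) = eval_xy (reduce_series \<Psi>) (reduce_series u) (reduce_series v)"
    unfolding eval_xy_def reduce_series_nsubst[OF assms(1) *] by simp
qed

text \<open>Reduction preserves the constant term 1, so both inverses are given by the same
  geometric series.\<close>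

lemma
  assumes "integral_series g" "ncoeff g [] = 1"
  shows integral_series_ninverse: "integral_series (ninverse g)"
    and reduce_series_ninverse: "reduce_series (ninverse g) = ninverse (reduce_series g)"
  using assms by (simp_all add: ninverse_eq_fps_at(1) reduce_simps reduce_intros)

section \<open>Reduction of the generators, the associator and the factor with \<pi> i\<close>

lemma integral_series_gen [reduce_intros]: "integral_series gen_a" "integral_series gen_b"
  and reduce_series_gen [reduce_simps]: "reduce_series gen_a = gen_a" "reduce_series gen_b = gen_b"
  by (simp_all add: gen_a_def gen_b_def reduce_simps reduce_intros)

lemma integral_series_t [reduce_intros]:
    "integral_series t01" "integral_series t02" "integral_series t12"
  and reduce_series_t [reduce_simps]:
    "reduce_series t01 = t01" "reduce_series t02 = t02" "reduce_series t12 = t12"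
  by (simp_all add: t01_def t02_def t12_def Ber_def reduce_simps reduce_intros)

lemma integral_series_Phi_KZ [reduce_intros]: "integral_series Phi_KZ"
  by (simp add: integral_series_def Phi_KZ_MZV MZV_2pii_base)

text \<open>The zeta value of the empty index is an empty product summed over the single empty
  tuple, hence 1. This makes the associator invertible after substitution.\<close>

lemma ncoeff_Phi_KZ_Nil: "ncoeff Phi_KZ [] = 1"
proof -
  have "{ms :: nat list. length ms = length ([] :: nat list) \<and> sorted_wrt (>) ms \<and> (\<forall>m\<in>set ms. 0 < m)} = {[]}"
    by auto
  then have "mzv [] = 1" by (simp add: mzv_def)
  then show ?thesis
    by (simp add: Phi_KZ_def zeta_reg_def zeta_word_def convergent_word_def)
qed

text \<open>At the empty word, the length bound in \<open>nsubst\<close> leaves only the empty word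
  of \<Psi>.\<close>

lemma ncoeff_eval_xy_Nil: "ncoeff (eval_xy \<Psi> u v) [] = ncoeff \<Psi> []"
proof -
  have "{w :: letter_xy list. length w \<le> 0} = {[]}" by auto
  then show ?thesis by (simp add: eval_xy_def nsubst_def)
qed

text \<open>Half of \<open>two_pi_i\<close> still lies in the ideal, because 1/2 is in the base
  ring.\<close>

lemma pi_i_MZV_2pii: "of_real pi * \<i> \<in> MZV_2pii" and red_pi_i: "red (of_real pi * \<i>) = 0"
proof -
  have eq: "of_real pi * \<i> = two_pi_i * of_rat (1 / 2)" by (simp add: of_rat_divide)
  show m: "of_real pi * \<i> \<in> MZV_2pii"
    unfolding eq by (intro MZV_2pii_mult MZV_2pii_gen rat_MZV_2pii)
  show "red (of_real pi * \<i>) = 0"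
    using red_eq_0_iff[OF m] eq rat_MZV_2pii by blast
qed

lemma reduce_nexp_pi_i:
  assumes "integral_series f"
  shows "integral_series (nexp (nscale (of_real pi * \<i>) f))"
    and "reduce_series (nexp (nscale (of_real pi * \<i>) f)) = 1"
proof -
  have i: "integral_series (nscale (of_real pi * \<i>) f)"
    by (rule integral_series_nscale[OF pi_i_MZV_2pii assms])
  then show "integral_series (nexp (nscale (of_real pi * \<i>) f))"
    unfolding nexp_def by (rule integral_series_fps_at)
  have "nscale 0 (reduce_series f) = 0" by (rule ncs_eqI) simp
  then have "reduce_series (nscale (of_real pi * \<i>) f) = 0"
    using assms by (simp only: reduce_series_nscale pi_i_MZV_2pii red_pi_i)
  then show "reduce_series (nexp (nscale (of_real pi * \<i>) f)) = 1"
    using nexp_0 i unfolding nexp_def by (simp add: reduce_simps)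
qed

section \<open>Comparison of the two automorphisms\<close>

theorem theorem3p3:
  fixes \<sigma> :: "(letter_ab, complex) ncs \<Rightarrow> (letter_ab, complex) ncs"
    and \<gamma> :: "(letter_ab, mzvbar) ncs \<Rightarrow> (letter_ab, mzvbar) ncs"
  assumes "is_sigma \<sigma>"
    and "is_Gamma (reduce_series Phi_KZ) \<gamma>"
  shows "(\<forall>w. ncoeff (1 - gen_a + \<sigma> gen_a) w \<in> MZV_2pii) \<and>
         reduce_series (1 - gen_a + \<sigma> gen_a) = 1 - gen_a + \<gamma> gen_a"
proof -
  define P where "P = eval_xy Phi_KZ t01 t12"
  define Q where "Q = eval_xy Phi_KZ t02 t12"
  have auto: "continuous_f2_automorphism \<sigma>" "continuous_f2_automorphism \<gamma>"
    using assms by (auto simp: is_sigma_def is_Gamma_def)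
  \<comment> \<open>Images under \<sigma> stay in \<open>f2\<close> and so have no constant term, as
    \<open>nlog_nexp\<close> requires.\<close>
  have ord: "ord_ge 1 (\<sigma> f)" if "f \<in> f2" for f
    using auto(1) that ord_ge_f2 by (auto simp: continuous_f2_automorphism_def bij_betw_def)
  have P1: "ncoeff P [] = 1" by (simp add: P_def ncoeff_eval_xy_Nil ncoeff_Phi_KZ_Nil)
  have P: "integral_series P" and Q: "integral_series Q"
    unfolding P_def Q_def by (intro reduce_intros)+
  have P': "integral_series (ninverse P)" "reduce_series (ninverse P) = ninverse (reduce_series P)"
    using P P1 by (simp_all add: integral_series_ninverse reduce_series_ninverse)
  have red_PQ: "reduce_series P = eval_xy (reduce_series Phi_KZ) t01 t12"
      "reduce_series Q = eval_xy (reduce_series Phi_KZ) t02 t12"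
    by (simp_all add: P_def Q_def reduce_simps reduce_intros)

  have t01_ord: "ord_ge 1 t01" by (rule ord_ge_f2[OF t01_f2])
  \<comment> \<open>The conjugation is pulled inside the exponential, so that the logarithm of both
    sides can be taken.\<close>
  have "nexp (\<sigma> t01) = nexp (P * t01 * ninverse P)"
    using assms(1) fps_at_conjugate[OF t01_ord ninverse_eq_fps_at(3)[OF P1] ninverse_eq_fps_at(2)[OF P1]]
    by (simp add: is_sigma_def P_def nexp_def)
  moreover have "ord_ge 1 (P * t01 * ninverse P)"
    using ord_ge_times[OF ord_ge_times[OF ord_ge_0 t01_ord] ord_ge_0] by simp
  ultimately have \<sigma>t: "\<sigma> t01 = P * t01 * ninverse P"
    using nlog_nexp ord[OF t01_f2] by metis
  \<comment> \<open>The solved equation has the shape of the condition on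
    \<open>\<gamma> t01\<close>, with coefficients before reduction.\<close>
  have int_t: "integral_series (\<sigma> t01)" and red_t: "reduce_series (\<sigma> t01) = \<gamma> t01"
    using assms(2) unfolding \<sigma>t
    by (simp_all add: reduce_simps reduce_intros P P' is_Gamma_def red_PQ)

  let ?e = "nexp (nscale (of_real pi * \<i>) t12)"
  have \<sigma>b: "\<sigma> gen_b = nlog (?e * Q * nexp gen_b * ninverse P)"
    using assms(1) nlog_nexp[OF ord[OF gen_f2(2)]] by (simp add: is_sigma_def P_def Q_def)
  have e: "integral_series ?e" "reduce_series ?e = 1"
    by (simp_all only: reduce_nexp_pi_i integral_series_t)
  have n: "integral_series (nexp gen_b)" "reduce_series (nexp gen_b) = nexp gen_b"
    by (simp_all add: nexp_def reduce_simps reduce_intros)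
  \<comment> \<open>The factor \<open>?e\<close> reduces to 1; what remains is the logarithm that
    defines \<open>\<gamma> gen_b\<close>.\<close>
  have int_b: "integral_series (\<sigma> gen_b)" and red_b: "reduce_series (\<sigma> gen_b) = \<gamma> gen_b"
    using assms(2) unfolding \<sigma>b nlog_def is_Gamma_def
    by (simp_all add: reduce_simps reduce_intros P P' Q e n red_PQ)

  \<comment> \<open>Both images of \<open>gen_a\<close> are the same series, evaluated at images of
    \<open>gen_b\<close> and \<open>t01\<close> that correspond under reduction.\<close>
  have int_a: "integral_series (\<sigma> gen_a)" and red_a: "reduce_series (\<sigma> gen_a) = \<gamma> gen_a"
    unfolding continuous_f2_automorphism_gen_a[OF auto(1)] continuous_f2_automorphism_gen_a[OF auto(2)]
    by (simp_all add: reduce_simps reduce_intros int_b int_t red_b red_t)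
  have "integral_series (1 - gen_a + \<sigma> gen_a)"
    by (simp add: reduce_intros int_a)
  moreover have "reduce_series (1 - gen_a + \<sigma> gen_a) = 1 - gen_a + \<gamma> gen_a"
    by (simp add: reduce_simps reduce_intros int_a red_a)
  ultimately show ?thesis by (simp add: integral_series_def)
qed

end
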